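(* For all even $n\in\mathbb{N}$, $Z_{DP}(n) \ge n^2/4 - n$.
   Context: All graphs are finite, undirected and simple; $\chi(G)$ is the chromatic number. For a graph $G$ and $s \in \mathbb{N}$, $\mathcal{J}(G,s)$ denotes the join of $G$ with a copy of $K_s$: the graph obtained from $G$ by adding $s$ new vertices adjacent to every vertex of $G$ and to each other. A cover of a graph $G$ is a pair $(L,H)$, where $H$ is a graph and $L\colon V(G)\to 2^{V(H)}$, such that: the sets $L(u)$, $u\in V(G)$, partition $V(H)$; if $u,v\in V(G)$ and some vertex of $L(v)$ is adjacent in $H$ to some vertex of $L(u)$, then $v=u$ or $uv\in E(G)$; each $H[L(u)]$ is a complete graph; and if $uv\in E(G)$, then the set of edges of $H$ between $L(u)$ and $L(v)$ is a matching (possibly empty). An $(L,H)$-coloring of $G$ is an independent set $I$ of $H$ with $|I\cap L(u)|=1$ for all $u\in V(G)$. The DP-chromatic number $\chi_{DP}(G)$ is the smallest $k$ such that $G$ is $(L,H)$-colorable for every cover $(L,H)$ with $|L(u)|\ge k$ for all $u$. $Z_{DP}(G) := \min\{ s\in \mathbb{N} : \chi_{DP}(\mathcal{J}(G,s)) = \chi(\mathcal{J}(G,s))\}$, and $Z_{DP}(n) := \max\{Z_{DP}(G) : G \text{ a graph with } |V(G)|=n\}$. *)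

theory Defs
  imports Complex_Main "HOL-Library.Disjoint_Sets" "Graph_Theory.Pair_Digraph"
begin

text \<open>
  A finite undirected simple graph is a \<open>pair_graph\<close>: finite, loop-free, and with a symmetric
  set of arcs, an edge \<open>uv\<close> being present as the two arcs \<open>(u, v)\<close> and \<open>(v, u)\<close>.
\<close>

definition proper_coloring :: "'a pair_pre_digraph \<Rightarrow> nat \<Rightarrow> ('a \<Rightarrow> nat) \<Rightarrow> bool" where
  "proper_coloring G k f \<longleftrightarrow>
     (\<forall>v \<in> pverts G. f v < k) \<and> (\<forall>(u, v) \<in> parcs G. f u \<noteq> f v)"

definition chromatic_number :: "'a pair_pre_digraph \<Rightarrow> nat" where
  "chromatic_number G = (LEAST k. \<exists>f. proper_coloring G k f)"

definition join_complete :: "'a pair_pre_digraph \<Rightarrow> nat \<Rightarrow> ('a + nat) pair_pre_digraph" where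
  "join_complete G s =
     \<lparr> pverts = Inl ` pverts G \<union> Inr ` {..<s},
       parcs = {(Inl u, Inl v) | u v. (u, v) \<in> parcs G}
             \<union> {(Inl u, Inr i) | u i. u \<in> pverts G \<and> i < s}
             \<union> {(Inr i, Inl u) | i u. i < s \<and> u \<in> pverts G}
             \<union> {(Inr i, Inr j) | i j. i < s \<and> j < s \<and> i \<noteq> j} \<rparr>"

definition edges_between :: "'b pair_pre_digraph \<Rightarrow> 'b set \<Rightarrow> 'b set \<Rightarrow> 'b set set" where
  "edges_between H A B = {{x, y} | x y. x \<in> A \<and> y \<in> B \<and> (x, y) \<in> parcs H}"

definition matching :: "'b set set \<Rightarrow> bool" where
  "matching M \<longleftrightarrow> disjoint M"

text \<open>
  The parts \<open>L u\<close> of the partition of the vertex set of \<open>H\<close> are allowed to be empty; the values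
  of \<open>L\<close> outside the vertex set of \<open>G\<close> are irrelevant.
\<close>

definition cover ::
    "'a pair_pre_digraph \<Rightarrow> ('a \<Rightarrow> 'b set) \<Rightarrow> 'b pair_pre_digraph \<Rightarrow> bool" where
  "cover G L H \<longleftrightarrow>
     pair_graph H \<and>
     disjoint_family_on L (pverts G) \<and> (\<Union>u \<in> pverts G. L u) = pverts H \<and>
     (\<forall>u \<in> pverts G. \<forall>v \<in> pverts G.
        (\<exists>x \<in> L u. \<exists>y \<in> L v. (x, y) \<in> parcs H) \<longrightarrow> v = u \<or> (u, v) \<in> parcs G) \<and>
     (\<forall>u \<in> pverts G. \<forall>x \<in> L u. \<forall>y \<in> L u. x \<noteq> y \<longrightarrow> (x, y) \<in> parcs H) \<and>
     (\<forall>(u, v) \<in> parcs G. matching (edges_between H (L u) (L v)))"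

definition independent_set :: "'b pair_pre_digraph \<Rightarrow> 'b set \<Rightarrow> bool" where
  "independent_set H I \<longleftrightarrow> I \<subseteq> pverts H \<and> (\<forall>x \<in> I. \<forall>y \<in> I. (x, y) \<notin> parcs H)"

definition cover_coloring ::
    "'a pair_pre_digraph \<Rightarrow> ('a \<Rightarrow> 'b set) \<Rightarrow> 'b pair_pre_digraph \<Rightarrow> 'b set \<Rightarrow> bool" where
  "cover_coloring G L H I \<longleftrightarrow>
     independent_set H I \<and> (\<forall>u \<in> pverts G. card (I \<inter> L u) = 1)"

text \<open>
  The graphs \<open>H\<close> of covers are finite, so up to isomorphism it is enough to let them range over
  graphs whose vertices are natural numbers. The same applies below to the graphs on \<open>n\<close> vertices.
\<close>

definition dp_chromatic_number :: "'a pair_pre_digraph \<Rightarrow> nat" where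
  "dp_chromatic_number G =
     (LEAST k. \<forall>(L :: 'a \<Rightarrow> nat set) H.
        cover G L H \<and> (\<forall>u \<in> pverts G. card (L u) \<ge> k) \<longrightarrow> (\<exists>I. cover_coloring G L H I))"

definition Z_DP :: "'a pair_pre_digraph \<Rightarrow> nat" where
  "Z_DP G = (LEAST s. dp_chromatic_number (join_complete G s) = chromatic_number (join_complete G s))"

definition Z_DP_max :: "nat \<Rightarrow> nat" where
  "Z_DP_max n = Max {Z_DP G | G :: nat pair_pre_digraph. pair_graph G \<and> card (pverts G) = n}"

end

theory Submission
  imports Defs
begin

text \<open>
  The graph is \<open>K\<^sub>m\<^sub>,\<^sub>m\<close> with \<open>n = 2m\<close>, for which \<open>\<chi>(J(G,s)) = s + 2\<close>. For \<open>s \<le> m\<^sup>2 - 2m\<close> a cover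
  with lists of size \<open>s + 2\<close> made of cyclic shifts has no colouring: the clique leaves only two
  colours, unshifted edges along a spanning tree determine the rest of the colouring, and each
  possible colouring violates one of the remaining \<open>(m - 1)\<^sup>2\<close> edges.

  The defining set of \<open>Z\<^sub>D\<^sub>P(G)\<close> must also be shown nonempty, since otherwise \<open>LEAST\<close> is an
  unspecified number: for large \<open>s\<close> one has \<open>\<chi>\<^sub>D\<^sub>P(J(G,s)) = s + 2\<close>. As long as some choice of colours
  for one or two clique vertices lets the list of a vertex outside the clique shrink less than
  generically, make it; boundedly many such gains suffice to make every vertex outside the clique
  colourable at the very end. If there is no such choice, the cover is so rigid that \<open>K\<^sub>m\<^sub>,\<^sub>m\<close> can be
  coloured while destroying at most two colours in each list of the clique. Likewise, the maximum
  \<open>Z\<^sub>D\<^sub>P(n)\<close> is meaningful because \<open>Z\<^sub>D\<^sub>P\<close> is invariant under isomorphism, so that it takes finitely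
  many values on graphs with \<open>n\<close> vertices.
\<close>

subsection \<open>List colourings of covers\<close>

text \<open>\<open>E\<close> stands for adjacency in the cover graph. No base graph occurs, so the
  same notion serves partial colourings and lists from which colours have been deleted.\<close>

definition list_coloring :: "('b \<Rightarrow> 'b \<Rightarrow> bool) \<Rightarrow> ('v \<Rightarrow> 'b set) \<Rightarrow> 'v set \<Rightarrow> ('v \<Rightarrow> 'b) \<Rightarrow> bool" where
  "list_coloring E L W \<phi> \<longleftrightarrow>
     (\<forall>v\<in>W. \<phi> v \<in> L v) \<and> (\<forall>u\<in>W. \<forall>v\<in>W. u \<noteq> v \<longrightarrow> \<not> E (\<phi> u) (\<phi> v))"

definition lost :: "('b \<Rightarrow> 'b \<Rightarrow> bool) \<Rightarrow> ('v \<Rightarrow> 'b) \<Rightarrow> 'v set \<Rightarrow> 'b set" where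
  "lost E \<phi> W = {y. \<exists>w\<in>W. E (\<phi> w) y}"

text \<open>For symmetric \<open>E\<close>, exchanging \<open>u\<close> and \<open>v\<close> gives
  the other half of the matching condition. In this form the property passes at once to
  sublists.\<close>

definition matched :: "('b \<Rightarrow> 'b \<Rightarrow> bool) \<Rightarrow> ('v \<Rightarrow> 'b set) \<Rightarrow> 'v set \<Rightarrow> bool" where
  "matched E L V \<longleftrightarrow>
     (\<forall>u\<in>V. \<forall>v\<in>V. u \<noteq> v \<longrightarrow>
        (\<forall>x\<in>L u. \<forall>y\<in>L v. \<forall>z\<in>L v. E x y \<longrightarrow> E x z \<longrightarrow> y = z))"

definition separated :: "('b \<Rightarrow> 'b \<Rightarrow> bool) \<Rightarrow> ('v \<Rightarrow> 'b set) \<Rightarrow> 'v set \<Rightarrow> bool" where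
  "separated E L X \<longleftrightarrow>
     (\<forall>u\<in>X. \<forall>v\<in>X. u \<noteq> v \<longrightarrow> (\<forall>x\<in>L u. \<forall>y\<in>L v. \<not> E x y))"

lemma matchedD:
  assumes "matched E L V" "u \<in> V" "v \<in> V" "u \<noteq> v" "x \<in> L u" "y \<in> L v" "z \<in> L v" "E x y" "E x z"
  shows "y = z"
  using assms unfolding matched_def by blast

lemma lost_Un: "lost E \<phi> (V \<union> W) = lost E \<phi> V \<union> lost E \<phi> W"
  by (auto simp: lost_def)

lemma lost_cong: "(\<And>w. w \<in> W \<Longrightarrow> \<phi> w = \<psi> w) \<Longrightarrow> lost E \<phi> W = lost E \<psi> W"
  by (auto simp: lost_def)

lemma matched_nbr_card_le_1:
  assumes "matched E L V" "u \<in> V" "v \<in> V" "u \<noteq> v" "x \<in> L u"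
  shows "card (L v \<inter> {y. E x y}) \<le> 1"
proof (cases "finite (L v \<inter> {y. E x y})")
  case True
  then show ?thesis
    using matchedD[OF assms] by (auto simp: card_le_Suc0_iff_eq)
qed simp

lemma card_lost_le:
  assumes "matched E L V" "W \<subseteq> V" "v \<in> V" "v \<notin> W" "finite W" "\<forall>w\<in>W. \<phi> w \<in> L w"
  shows "card (L v \<inter> lost E \<phi> W) \<le> card W"
proof -
  have "L v \<inter> lost E \<phi> W = (\<Union>w\<in>W. L v \<inter> {y. E (\<phi> w) y})"
    by (auto simp: lost_def)
  also have "card \<dots> \<le> (\<Sum>w\<in>W. card (L v \<inter> {y. E (\<phi> w) y}))"
    using \<open>finite W\<close> by (rule card_UN_le)
  also have "\<dots> \<le> (\<Sum>w\<in>W. 1)"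
  proof (rule sum_mono)
    fix w assume "w \<in> W"
    then show "card (L v \<inter> {y. E (\<phi> w) y}) \<le> 1"
      using assms by (intro matched_nbr_card_le_1[OF assms(1), of w]) auto
  qed
  finally show ?thesis by simp
qed

section \<open>Greedy extension and combination of list colourings\<close>

lemma list_coloring_extend:
  assumes "symp E" "list_coloring E L W \<phi>" "v \<notin> W" "finite (L v)"
    and "card (L v \<inter> lost E \<phi> W) < card (L v)"
  obtains x where "list_coloring E L (insert v W) (\<phi>(v := x))"
proof -
  obtain x where x: "x \<in> L v" "x \<notin> lost E \<phi> W"
    using assms by (metis Int_absorb2 nat_neq_iff subsetI)
  have "\<not> E (\<phi> w) x" if "w \<in> W" for w
    using x that by (auto simp: lost_def)
  moreover from this have "\<not> E x (\<phi> w)" if "w \<in> W" for w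
    using sympD[OF \<open>symp E\<close>] that by blast
  ultimately have "list_coloring E L (insert v W) (\<phi>(v := x))"
    using assms x by (auto simp: list_coloring_def)
  then show ?thesis by (rule that)
qed

text \<open>Greedy colouring of \<open>B\<close>: a vertex of \<open>B\<close> loses at most one
  colour to each member coloured before it, and there are fewer than \<open>card B\<close> of
  these.\<close>

lemma list_coloring_extend_set:
  assumes "symp E" "matched E L (W \<union> B)" "finite B" "W \<inter> B = {}" "list_coloring E L W \<phi>"
    and "\<forall>v\<in>B. finite (L v) \<and> card (L v \<inter> lost E \<phi> W) + card B \<le> card (L v)"
  shows "\<exists>\<psi>. list_coloring E L (W \<union> B) \<psi>"
proof -
  \<comment> \<open>Keeping \<open>\<psi>\<close> equal to \<open>\<phi>\<close> on \<open>W\<close>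
    makes the hypothesis on \<open>lost E \<phi> W\<close> available at every stage.\<close>
  have "\<exists>\<psi>. list_coloring E L (W \<union> C) \<psi> \<and> (\<forall>w\<in>W. \<psi> w = \<phi> w)" if "C \<subseteq> B" for C
    using finite_subset[OF that \<open>finite B\<close>] that
  proof (induction C)
    case empty
    then show ?case using assms by auto
  next
    case (insert v C)
    then obtain \<psi> where \<psi>: "list_coloring E L (W \<union> C) \<psi>" "\<forall>w\<in>W. \<psi> w = \<phi> w"
      by auto
    have "L v \<inter> lost E \<psi> (W \<union> C) = L v \<inter> lost E \<phi> W \<union> L v \<inter> lost E \<psi> C"
      using lost_cong[of W \<psi> \<phi> E] \<psi> by (auto simp: lost_Un)
    then have "card (L v \<inter> lost E \<psi> (W \<union> C)) \<le> card (L v \<inter> lost E \<phi> W) + card (L v \<inter> lost E \<psi> C)"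
      by (simp add: card_Un_le)
    also have "card (L v \<inter> lost E \<psi> C) \<le> card C"
      using insert \<psi> assms by (intro card_lost_le[OF assms(2)]) (auto simp: list_coloring_def)
    also have "card C < card B"
      using insert assms by (intro psubset_card_mono) auto
    finally have "card (L v \<inter> lost E \<psi> (W \<union> C)) < card (L v)"
      using assms insert by fastforce
    then obtain x where "list_coloring E L (insert v (W \<union> C)) (\<psi>(v := x))"
      using list_coloring_extend[OF \<open>symp E\<close> \<psi>(1), of v] insert assms by blast
    then have "list_coloring E L (W \<union> insert v C) (\<psi>(v := x))"
      unfolding Un_insert_right .
    moreover have "\<forall>w\<in>W. (\<psi>(v := x)) w = \<phi> w" using \<psi> insert assms by auto
    ultimately show ?case by blast
  qed
  then show ?thesis by blast
qed

text \<open>Deleting the colours destroyed by \<open>S\<close> encodes all constraints that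
  \<open>S\<close> imposes, so the remaining vertices form a smaller instance of the same
  problem.\<close>

lemma list_coloring_combine:
  assumes "symp E" "list_coloring E L S \<phi>" "list_coloring E (\<lambda>v. L v - lost E \<phi> S) W \<psi>" "S \<inter> W = {}"
  shows "list_coloring E L (S \<union> W) (\<lambda>v. if v \<in> S then \<phi> v else \<psi> v)"
proof -
  have "\<not> E (\<phi> u) (\<psi> v)" if "u \<in> S" "v \<in> W" for u v
    using assms(3) that by (auto simp: list_coloring_def lost_def)
  moreover from this have "\<not> E (\<psi> v) (\<phi> u)" if "u \<in> S" "v \<in> W" for u v
    using sympD[OF \<open>symp E\<close>] that by blast
  ultimately show ?thesis
    using assms by (auto simp: list_coloring_def)
qed

text \<open>A colour \<open>i\<close> of \<open>a\<close> is carried over to every \<open>u\<close> outside the clique through the matching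
  between \<open>L a\<close> and \<open>L u\<close>. The colours of another clique vertex \<open>b\<close> destroyed by these copies of
  \<open>i\<close> are all adjacent to \<open>i\<close> itself, so \<open>b\<close> loses only one colour. Hence if \<open>X\<close> is coloured by
  copies of \<open>i\<close> and \<open>Y\<close> by copies of \<open>j\<close>, every clique vertex loses at most two.\<close>

lemma list_coloring_no_gain:
  assumes "symp E" and fin: "finite A" "finite X" "finite Y"
    and disj: "A \<inter> (X \<union> Y) = {}" "X \<inter> Y = {}"
    and lists: "\<forall>v\<in>A. finite (L v) \<and> card A + 2 \<le> card (L v)"
    and M: "matched E L (A \<union> (X \<union> Y))" and "separated E L X" "separated E L Y"
    and "a \<in> A" and big: "card X * card Y < card (L a)"
    and nbr: "\<And>b c u. b \<in> A \<Longrightarrow> c \<in> L b \<Longrightarrow> u \<in> X \<union> Y \<Longrightarrow> \<exists>y\<in>L u. E c y"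
    and common: "\<And>b b' c d u y. b \<in> A \<Longrightarrow> b' \<in> A \<Longrightarrow> b \<noteq> b' \<Longrightarrow> c \<in> L b \<Longrightarrow> d \<in> L b' \<Longrightarrow>
      u \<in> X \<union> Y \<Longrightarrow> y \<in> L u \<Longrightarrow> E c y \<Longrightarrow> E d y \<Longrightarrow> E c d"
  shows "\<exists>\<phi>. list_coloring E L (A \<union> (X \<union> Y)) \<phi>"
proof -
  have symE: "E x y \<Longrightarrow> E y x" for x y using \<open>symp E\<close> by (auto dest: sympD)
  \<comment> \<open>The copy of \<open>c\<close> at \<open>u\<close>: it exists by
    \<open>nbr\<close>, and the matching makes it unique.\<close>
  define f where "f u c = (SOME y. y \<in> L u \<and> E c y)" for u c
  have f: "f u c \<in> L u \<and> E c (f u c)" if "c \<in> L a" "u \<in> X \<union> Y" for c u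
    unfolding f_def by (rule someI_ex) (use nbr[OF \<open>a \<in> A\<close> that] in blast)
  have fE: "E (f u c) c" if "c \<in> L a" "u \<in> X \<union> Y" for c u
    using f[OF that] symE by blast
  have inj: "c = d" if "c \<in> L a" "d \<in> L a" "u \<in> X \<union> Y" "f u c = f u d" for c d u
  proof (rule matchedD[OF M, of u a "f u c"])
    show "u \<noteq> a" using that disj \<open>a \<in> A\<close> by blast
    show "E (f u c) d" unfolding \<open>f u c = f u d\<close> using fE that by blast
  qed (use f fE that \<open>a \<in> A\<close> in blast)+
  have one: "card (L b \<inter> {y. \<exists>u\<in>X\<union>Y. E (f u i) y}) \<le> 1" if "i \<in> L a" "b \<in> A" for i b
  proof (cases "b = a")
    case True
    have "y = i" if "y \<in> L a" "u \<in> X \<union> Y" "E (f u i) y" for u y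
    proof (rule matchedD[OF M, of u a "f u i"])
      show "u \<noteq> a" using that disj \<open>a \<in> A\<close> by blast
    qed (use f fE that \<open>i \<in> L a\<close> \<open>a \<in> A\<close> in blast)+
    then have "L b \<inter> {y. \<exists>u\<in>X\<union>Y. E (f u i) y} \<subseteq> {i}" using True by blast
    then have "card (L b \<inter> {y. \<exists>u\<in>X\<union>Y. E (f u i) y}) \<le> card {i}"
      by (intro card_mono) auto
    then show ?thesis by simp
  next
    case False
    have "L b \<inter> {y. \<exists>u\<in>X\<union>Y. E (f u i) y} \<subseteq> L b \<inter> {y. E i y}"
    proof clarify
      fix y u assume y: "y \<in> L b" "E (f u i) y" and u: "u \<in> X \<union> Y"
      have "E y (f u i)" using y symE by blast
      then show "E i y"
        using common[of a b i y u "f u i"] f[OF \<open>i \<in> L a\<close> u] y u False that \<open>a \<in> A\<close>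
        by blast
    qed
    then have "card (L b \<inter> {y. \<exists>u\<in>X\<union>Y. E (f u i) y}) \<le> card (L b \<inter> {y. E i y})"
      using lists that by (intro card_mono) auto
    also have "\<dots> \<le> 1"
    proof (rule matched_nbr_card_le_1[OF M, of a])
    qed (use that False \<open>a \<in> A\<close> in auto)
    finally show ?thesis .
  qed
  have "L a \<noteq> {}" using big by auto
  then obtain i where i: "i \<in> L a" by blast
  \<comment> \<open>The colours \<open>j\<close> whose copies on \<open>Y\<close> clash with the
    copies of \<open>i\<close> on \<open>X\<close>. Each pair \<open>(u, v)\<close> excludes at most
    one \<open>j\<close>, because \<open>f u i\<close> has at most one neighbour in
    \<open>L v\<close> and copying is injective.\<close>
  let ?conf = "\<Union>(u,v)\<in>X \<times> Y. {j \<in> L a. E (f u i) (f v j)}"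
  have "card ?conf \<le> (\<Sum>p\<in>X \<times> Y. card (case p of (u,v) \<Rightarrow> {j \<in> L a. E (f u i) (f v j)}))"
    using fin by (intro card_UN_le) auto
  also have "\<dots> \<le> (\<Sum>p\<in>X \<times> Y. 1)"
  proof (intro sum_mono, clarify)
    fix u v assume uv: "u \<in> X" "v \<in> Y"
    have "j = j'" if "j \<in> L a" "j' \<in> L a" "E (f u i) (f v j)" "E (f u i) (f v j')" for j j'
    proof (rule inj[where u = v])
      show "f v j = f v j'"
        using uv that f[of i u] f[of j v] f[of j' v] i disj
        by (intro matchedD[OF M, of u v "f u i"]) auto
    qed (use uv that in auto)
    then show "card {j \<in> L a. E (f u i) (f v j)} \<le> 1"
      using lists \<open>a \<in> A\<close> by (auto simp: card_le_Suc0_iff_eq)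
  qed
  also have "\<dots> < card (L a)" using big by (simp add: card_cartesian_product)
  finally have "card ?conf < card (L a)" .
  moreover have "finite ?conf" using fin lists \<open>a \<in> A\<close> by auto
  ultimately have "\<not> L a \<subseteq> ?conf" by (meson card_mono leD)
  then obtain j where j: "j \<in> L a" "j \<notin> ?conf" by blast
  define \<phi> where "\<phi> u = (if u \<in> X then f u i else f u j)" for u
  have XY: "\<not> E (f u i) (f v j)" if "u \<in> X" "v \<in> Y" for u v
    using j that by auto
  have YX: "\<not> E (f v j) (f u i)" if "u \<in> X" "v \<in> Y" for u v
    using XY[OF that] symE by blast
  have XX: "\<not> E (f u c) (f v c)" if "u \<in> X" "v \<in> X" "u \<noteq> v" "c \<in> L a" for u v c
    using \<open>separated E L X\<close> f that unfolding separated_def by blast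
  have YY: "\<not> E (f u c) (f v c)" if "u \<in> Y" "v \<in> Y" "u \<noteq> v" "c \<in> L a" for u v c
    using \<open>separated E L Y\<close> f that unfolding separated_def by blast
  have col: "list_coloring E L (X \<union> Y) \<phi>"
    using XX[OF _ _ _ i] YY[OF _ _ _ j(1)] XY YX f[OF i] f[OF j(1)] \<open>X \<inter> Y = {}\<close>
    unfolding list_coloring_def \<phi>_def by auto
  \<comment> \<open>The clique comes last: each of its lists loses at most two colours and keeps at
    least \<open>card A\<close>, enough for the greedy extension.\<close>
  have "card (L b \<inter> lost E \<phi> (X \<union> Y)) + card A \<le> card (L b)" if "b \<in> A" for b
  proof -
    have "L b \<inter> lost E \<phi> (X \<union> Y) \<subseteq>
        L b \<inter> {y. \<exists>u\<in>X\<union>Y. E (f u i) y} \<union> L b \<inter> {y. \<exists>u\<in>X\<union>Y. E (f u j) y}"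
      by (auto simp: lost_def \<phi>_def split: if_splits)
    then have "card (L b \<inter> lost E \<phi> (X \<union> Y)) \<le>
        card (L b \<inter> {y. \<exists>u\<in>X\<union>Y. E (f u i) y} \<union> L b \<inter> {y. \<exists>u\<in>X\<union>Y. E (f u j) y})"
      using lists that by (intro card_mono) auto
    also have "\<dots> \<le> 1 + 1"
      using one[OF i that] one[OF j(1) that] by (intro order_trans[OF card_Un_le] add_mono)
    finally show ?thesis using lists that by fastforce
  qed
  then have "\<exists>\<psi>. list_coloring E L (X \<union> Y \<union> A) \<psi>"
    using M fin disj lists col
    by (intro list_coloring_extend_set[OF \<open>symp E\<close>, of L "X \<union> Y" A \<phi>]) (auto simp: Un_ac)
  then show ?thesis by (simp add: Un_ac)
qed

section \<open>Induction for the join of a clique with a bipartite graph\<close>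

lemma matched_subset:
  assumes "matched E L V" "W \<subseteq> V" "\<And>v. v \<in> W \<Longrightarrow> K v \<subseteq> L v"
  shows "matched E K W"
  using assms unfolding matched_def by (meson subsetD)

lemma separated_subset:
  assumes "separated E L X" "Y \<subseteq> X" "\<And>v. v \<in> Y \<Longrightarrow> K v \<subseteq> L v"
  shows "separated E K Y"
  using assms unfolding separated_def by (meson subsetD)

text \<open>The other vertices of \<open>X\<close> destroy nothing in \<open>L u\<close>, so
  \<open>u\<close> loses at most \<open>card A + card Y\<close> colours and can be coloured
  last.\<close>

lemma list_colorable_insert_low_degree:
  assumes "symp E" "matched E L (A \<union> (X \<union> Y))" "separated E L X" "finite A" "finite Y"
    and u: "u \<in> X" "u \<notin> A \<union> Y" "finite (L u)" "card A + card Y < card (L u)"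
    and "\<exists>\<phi>. list_coloring E L (A \<union> ((X - {u}) \<union> Y)) \<phi>"
  shows "\<exists>\<phi>. list_coloring E L (A \<union> (X \<union> Y)) \<phi>"
proof -
  obtain \<phi> where \<phi>: "list_coloring E L (A \<union> ((X - {u}) \<union> Y)) \<phi>"
    using assms by blast
  have "x \<notin> lost E \<phi> (X - {u})" if "x \<in> L u" for x
    using \<phi> that \<open>separated E L X\<close> u(1)
    unfolding list_coloring_def separated_def lost_def by blast
  then have "L u \<inter> lost E \<phi> (A \<union> ((X - {u}) \<union> Y)) = L u \<inter> lost E \<phi> (A \<union> Y)"
    by (auto simp: lost_Un)
  also have "card \<dots> \<le> card (A \<union> Y)"
    using \<phi> assms by (intro card_lost_le[OF assms(2)]) (auto simp: list_coloring_def)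
  also have "\<dots> < card (L u)" using card_Un_le[of A Y] u by linarith
  finally obtain x where
    "list_coloring E L (insert u (A \<union> ((X - {u}) \<union> Y))) (\<phi>(u := x))"
    using list_coloring_extend[OF \<open>symp E\<close> \<phi>, of u] u by auto
  moreover have "insert u (A \<union> ((X - {u}) \<union> Y)) = A \<union> (X \<union> Y)"
    using u by auto
  ultimately show ?thesis by metis
qed

text \<open>The induction is on the total number of colours which the vertices outside the clique still
  need to gain before they can be dropped. Colouring one or two clique vertices such that some
  list \<open>L u\<close> loses fewer colours than vertices were coloured is a gain for \<open>u\<close>.\<close>

lemma list_colorable_join_bipartite:
  assumes "symp E" "finite A" "finite X" "finite Y"
    and "A \<inter> (X \<union> Y) = {}" "X \<inter> Y = {}" "card X \<le> m" "card Y \<le> m"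
    and "\<forall>v\<in>A\<union>(X\<union>Y). finite (L v) \<and> card A + 2 \<le> card (L v)"
    and "matched E L (A \<union> (X \<union> Y))" "separated E L X" "separated E L Y"
    and "m * m + 1 + 2 * (\<Sum>u\<in>X\<union>Y. Suc (card A + m + 1 - card (L u))) \<le> card A"
  shows "\<exists>\<phi>. list_coloring E L (A \<union> (X \<union> Y)) \<phi>"
  using assms
proof (induction "\<Sum>u\<in>X\<union>Y. Suc (card A + m + 1 - card (L u))" arbitrary: A X Y L rule: less_induct)
  case less
  \<comment> \<open>The gains still missing at \<open>u\<close>, plus one; the \<open>Suc\<close>
    makes the sum drop strictly when a vertex with no missing gains is removed.\<close>
  define g where "g u = Suc (card A + m + 1 - card (L u))" for u
  note prems = less.prems
  have M: "matched E L (A \<union> (X \<union> Y))" by fact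
  consider (dropX) u where "u \<in> X" "card A + m < card (L u)"
    | (dropY) u where "u \<in> Y" "card A + m < card (L u)"
    | (gain) S \<phi> u where "S \<subseteq> A" "S \<noteq> {}" "card S \<le> 2" "list_coloring E L S \<phi>" "u \<in> X \<union> Y"
        "card (L u \<inter> lost E \<phi> S) < card S" "card (L u) \<le> card A + m"
    | (final) "\<And>S \<phi> u. S \<subseteq> A \<Longrightarrow> S \<noteq> {} \<Longrightarrow> card S \<le> 2 \<Longrightarrow> list_coloring E L S \<phi> \<Longrightarrow>
        u \<in> X \<union> Y \<Longrightarrow> card S \<le> card (L u \<inter> lost E \<phi> S)"
    by (metis Un_iff leI)
  then show ?case
  proof cases
    case dropX
    have dec: "sum g (X - {u} \<union> Y) < sum g (X \<union> Y)"
      using dropX prems by (intro sum_strict_mono2[of _ _ u]) (auto simp: g_def)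
    have "card (X - {u}) \<le> m" using prems card_mono[of X "X - {u}"] by auto
    then have "\<exists>\<phi>. list_coloring E L (A \<union> ((X - {u}) \<union> Y)) \<phi>"
      using dec prems unfolding g_def
      by (intro less.hyps) (auto intro: matched_subset[OF M] separated_subset[of E L X])
    then show ?thesis
      using prems dropX by (intro list_colorable_insert_low_degree[of E L A X Y u]) auto
  next
    case dropY
    have dec: "sum g (X \<union> (Y - {u})) < sum g (X \<union> Y)"
      using dropY prems by (intro sum_strict_mono2[of _ _ u]) (auto simp: g_def)
    have "card (Y - {u}) \<le> m" using prems card_mono[of Y "Y - {u}"] by auto
    then have "\<exists>\<phi>. list_coloring E L (A \<union> (X \<union> (Y - {u}))) \<phi>"
      using dec prems unfolding g_def
      by (intro less.hyps) (auto intro: matched_subset[OF M] separated_subset[of E L Y])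
    then have "\<exists>\<phi>. list_coloring E L (A \<union> (Y \<union> X)) \<phi>"
      using prems dropY
      by (intro list_colorable_insert_low_degree[of E L A Y X u]) (auto simp: Un_ac)
    then show ?thesis by (simp add: Un_ac)
  next
    case gain
    define K where "K v = L v - lost E \<phi> S" for v
    define h where "h v = Suc (card (A - S) + m + 1 - card (K v))" for v
    have "finite S" using gain prems by (auto intro: finite_subset)
    have "card S \<noteq> 0" using gain \<open>finite S\<close> by auto
    have cA: "card (A - S) = card A - card S" "card S \<le> card A"
      using gain prems \<open>finite S\<close> by (auto intro: card_Diff_subset card_mono)
    have cK: "card (K v) = card (L v) - card (L v \<inter> lost E \<phi> S)" if "v \<in> A \<union> (X \<union> Y)" for v
      using prems that unfolding K_def by (simp add: card_Diff_subset_Int)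
    have loss: "card (L v \<inter> lost E \<phi> S) \<le> card S" if "v \<in> (A - S) \<union> (X \<union> Y)" for v
      using gain prems that \<open>finite S\<close>
      by (intro card_lost_le[OF M]) (auto simp: list_coloring_def)
    have K: "finite (K v) \<and> card (A - S) + 2 \<le> card (K v)" if "v \<in> (A - S) \<union> (X \<union> Y)" for v
    proof -
      have "v \<in> A \<union> (X \<union> Y)" using that by blast
      then have "finite (L v)" "card A + 2 \<le> card (L v)" using prems by blast+
      then show ?thesis
        using cK[OF \<open>v \<in> A \<union> (X \<union> Y)\<close>] loss[OF that] cA by (auto simp: K_def)
    qed
    have le: "h v \<le> g v" if "v \<in> X \<union> Y" for v
      using loss[of v] cK[of v] that cA unfolding h_def g_def by fastforce
    \<comment> \<open>Since \<open>card (L u) \<le> card A + m\<close>, the truncated difference in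
      \<open>g u\<close> is positive, so the gain really lowers it.\<close>
    have lt: "h u < g u"
      using gain(5,6,7) cK[of u] cA unfolding h_def g_def by fastforce
    have dec: "sum h (X \<union> Y) < sum g (X \<union> Y)"
      using le lt gain(5) prems by (intro sum_strict_mono_ex1) auto
    \<comment> \<open>At most two clique vertices are spent while the sum falls by at least one,
      which is why it carries the factor 2.\<close>
    have size: "m * m + 1 + 2 * sum h (X \<union> Y) \<le> card (A - S)"
      using prems(13) dec gain(3) cA unfolding g_def by linarith
    have "\<exists>\<psi>. list_coloring E K ((A - S) \<union> (X \<union> Y)) \<psi>"
    proof (rule less.hyps)
      show "matched E K (A - S \<union> (X \<union> Y))" by (rule matched_subset[OF M]) (auto simp: K_def)
      show "separated E K X" "separated E K Y"
        using separated_subset[OF prems(11), of X K] separated_subset[OF prems(12), of Y K]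
        by (auto simp: K_def)
    qed (use prems dec size K in \<open>auto simp: h_def g_def\<close>)
    then obtain \<psi> where "list_coloring E K ((A - S) \<union> (X \<union> Y)) \<psi>" by blast
    then have "list_coloring E L (S \<union> ((A - S) \<union> (X \<union> Y))) (\<lambda>v. if v \<in> S then \<phi> v else \<psi> v)"
      using gain prems unfolding K_def by (intro list_coloring_combine) auto
    moreover have "S \<union> ((A - S) \<union> (X \<union> Y)) = A \<union> (X \<union> Y)" using gain by blast
    ultimately show ?thesis by metis
  next
    case final
    have "0 < card A" "m * m < card A" using prems by auto
    then obtain a where a: "a \<in> A" by (metis card.empty ex_in_conv less_irrefl)
    show ?thesis
    proof (rule list_coloring_no_gain[where a = a])
      have "card X * card Y \<le> m * m" using prems by (intro mult_le_mono) auto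
      moreover have "card A + 2 \<le> card (L a)" using prems(9) a by blast
      ultimately show "card X * card Y < card (L a)" using \<open>m * m < card A\<close> by linarith
    next
      \<comment> \<open>With \<open>S = {b}\<close>, the absence of a gain says that every colour of
        \<open>b\<close> destroys one in \<open>L u\<close>.\<close>
      fix b c u assume *: "b \<in> A" "c \<in> L b" "u \<in> X \<union> Y"
      have "list_coloring E L {b} (\<lambda>_. c)" using * by (auto simp: list_coloring_def)
      then have "card {b} \<le> card (L u \<inter> lost E (\<lambda>_. c) {b})" using * by (intro final) auto
      then have "L u \<inter> lost E (\<lambda>_. c) {b} \<noteq> {}" by auto
      then show "\<exists>y\<in>L u. E c y" by (auto simp: lost_def)
    next
      fix b b' c d u y
      assume *: "b \<in> A" "b' \<in> A" "b \<noteq> b'" "c \<in> L b" "d \<in> L b'"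
        "u \<in> X \<union> Y" "y \<in> L u" "E c y" "E d y"
      show "E c d"
      \<comment> \<open>If \<open>c\<close> and \<open>d\<close> were nonadjacent, both could be
        used; sharing the neighbour \<open>y\<close>, they would cost \<open>L u\<close> only one
        colour for two vertices, a gain.\<close>
      proof (rule ccontr)
        assume "\<not> E c d"
        moreover from this have "\<not> E d c" using \<open>symp E\<close> by (blast dest: sympD)
        ultimately have "list_coloring E L {b, b'} (\<lambda>v. if v = b then c else d)"
          using * by (auto simp: list_coloring_def)
        then have "card {b, b'} \<le> card (L u \<inter> lost E (\<lambda>v. if v = b then c else d) {b, b'})"
          using * by (intro final) auto
        moreover have "u \<noteq> b" "u \<noteq> b'" using * prems by blast+
        then have uniq: "z = y" if "z \<in> L u" "E c z \<or> E d z" for z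
          using matchedD[OF M, of b u c z y] matchedD[OF M, of b' u d z y] * that by blast
        moreover have "lost E (\<lambda>v. if v = b then c else d) {b, b'} = {z. E c z \<or> E d z}"
          using \<open>b \<noteq> b'\<close> by (auto simp: lost_def)
        ultimately have "card {b, b'} \<le> card (L u \<inter> {z. E c z \<or> E d z})" by simp
        moreover have "L u \<inter> {z. E c z \<or> E d z} \<subseteq> {y}" using uniq by blast
        then have "card (L u \<inter> {z. E c z \<or> E d z}) \<le> card {y}"
          by (intro card_mono) auto
        ultimately show False using \<open>b \<noteq> b'\<close> by simp
      qed
    qed (use prems a in auto)
  qed
qed

section \<open>Finite simple graphs and their joins with cliques\<close>

lemma pair_graphI:
  assumes "finite (pverts G)"
    and "\<And>u v. (u, v) \<in> parcs G \<Longrightarrow> u \<in> pverts G \<and> v \<in> pverts G \<and> u \<noteq> v \<and> (v, u) \<in> parcs G"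
  shows "pair_graph G"
proof -
  have "parcs G \<subseteq> pverts G \<times> pverts G" using assms(2) by auto
  then have "finite (parcs G)" using assms(1) by (meson finite_SigmaI finite_subset)
  have "sym (parcs G)" using assms(2) by (intro symI) blast
  then show ?thesis
    using assms \<open>finite (parcs G)\<close>
    by unfold_locales (auto simp: symmetric_def with_proj_simps)
qed

lemma pair_graphD:
  assumes "pair_graph G"
  shows "finite (pverts G)"
    and "(u, v) \<in> parcs G \<Longrightarrow> u \<in> pverts G \<and> v \<in> pverts G \<and> u \<noteq> v \<and> (v, u) \<in> parcs G"
proof -
  interpret pair_graph G by fact
  show "finite (pverts G)" by (rule pair_finite_verts)
  show "u \<in> pverts G \<and> v \<in> pverts G \<and> u \<noteq> v \<and> (v, u) \<in> parcs G" if "(u, v) \<in> parcs G"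
  proof -
    have "sym (parcs G)" using pair_sym_arcs by (simp add: symmetric_def)
    then have "(v, u) \<in> parcs G" using that by (rule symD)
    then show ?thesis
      using in_arcsD1[OF that] in_arcsD2[OF that] pair_no_loops[OF that] by simp
  qed
qed

lemma pair_graph_join_complete:
  assumes "pair_graph G"
  shows "pair_graph (join_complete G s)"
proof (rule pair_graphI)
  show "finite (pverts (join_complete G s))"
    using pair_graphD(1)[OF assms] by (simp add: join_complete_def)
  fix u v assume "(u, v) \<in> parcs (join_complete G s)"
  then show "u \<in> pverts (join_complete G s) \<and> v \<in> pverts (join_complete G s) \<and> u \<noteq> v \<and>
      (v, u) \<in> parcs (join_complete G s)"
    by (cases u; cases v) (simp_all add: join_complete_def image_iff, use pair_graphD(2)[OF assms] in blast)
qed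

definition dp_colorable :: "'a pair_pre_digraph \<Rightarrow> nat \<Rightarrow> bool" where
  "dp_colorable G k \<longleftrightarrow> (\<forall>(L :: 'a \<Rightarrow> nat set) H.
     cover G L H \<and> (\<forall>u \<in> pverts G. card (L u) \<ge> k) \<longrightarrow> (\<exists>I. cover_coloring G L H I))"

lemma dp_chromatic_number_eq: "dp_chromatic_number G = (LEAST k. dp_colorable G k)"
  unfolding dp_chromatic_number_def dp_colorable_def ..

subsection \<open>Covers as list colourings\<close>

abbreviation adj :: "'b pair_pre_digraph \<Rightarrow> 'b \<Rightarrow> 'b \<Rightarrow> bool" where
  "adj H \<equiv> \<lambda>x y. (x, y) \<in> parcs H"

lemma symp_adj:
  assumes "pair_graph H"
  shows "symp (adj H)"
  by (rule sympI) (use pair_graphD(2)[OF assms] in blast)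

lemma coverD:
  assumes "cover G L H"
  shows "pair_graph H" and "disjoint_family_on L (pverts G)"
    and "(\<Union>u\<in>pverts G. L u) = pverts H"
    and "\<lbrakk>u \<in> pverts G; v \<in> pverts G; x \<in> L u; y \<in> L v; adj H x y\<rbrakk> \<Longrightarrow> v = u \<or> (u, v) \<in> parcs G"
    and "\<lbrakk>u \<in> pverts G; x \<in> L u; y \<in> L u; x \<noteq> y\<rbrakk> \<Longrightarrow> adj H x y"
    and "(u, v) \<in> parcs G \<Longrightarrow> disjoint (edges_between H (L u) (L v))"
proof -
  note c = assms[unfolded cover_def matching_def]
  show "pair_graph H" "disjoint_family_on L (pverts G)" "(\<Union>u\<in>pverts G. L u) = pverts H"
    using c by simp_all
  show "v = u \<or> (u, v) \<in> parcs G"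
    if "u \<in> pverts G" "v \<in> pverts G" "x \<in> L u" "y \<in> L v" "adj H x y"
    using conjunct1[OF conjunct2[OF conjunct2[OF conjunct2[OF c]]]] that by blast
  show "adj H x y" if "u \<in> pverts G" "x \<in> L u" "y \<in> L u" "x \<noteq> y"
    using conjunct1[OF conjunct2[OF conjunct2[OF conjunct2[OF conjunct2[OF c]]]]] that by blast
  show "disjoint (edges_between H (L u) (L v))" if "(u, v) \<in> parcs G"
    using conjunct2[OF conjunct2[OF conjunct2[OF conjunct2[OF conjunct2[OF c]]]]] that by blast
qed

lemma cover_finite:
  assumes "cover G L H" "u \<in> pverts G"
  shows "finite (L u)"
proof (rule finite_subset)
  show "L u \<subseteq> pverts H" using coverD(3)[OF assms(1)] assms(2) by blast
  show "finite (pverts H)" using coverD(1)[OF assms(1)] by (rule pair_graphD(1))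
qed

lemma cover_separated:
  assumes "cover G L H" "X \<subseteq> pverts G" "\<And>u v. u \<in> X \<Longrightarrow> v \<in> X \<Longrightarrow> (u, v) \<notin> parcs G"
  shows "separated (adj H) L X"
  unfolding separated_def
proof (intro ballI impI notI)
  fix u v x y assume "u \<in> X" "v \<in> X" "u \<noteq> v" "x \<in> L u" "y \<in> L v" "adj H x y"
  then show False using coverD(4)[OF assms(1), of u v x y] assms(2,3) by blast
qed

lemma cover_matched:
  assumes "cover G L H"
  shows "matched (adj H) L (pverts G)"
  unfolding matched_def
proof (intro ballI impI)
  fix u v x y z
  assume *: "u \<in> pverts G" "v \<in> pverts G" "u \<noteq> v" "x \<in> L u" "y \<in> L v" "z \<in> L v"
    "adj H x y" "adj H x z"
  have "disjoint (edges_between H (L u) (L v))"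
    using coverD(4)[OF assms, of u v x y] coverD(6)[OF assms, of u v] * by blast
  moreover have "{x, y} \<in> edges_between H (L u) (L v)" "{x, z} \<in> edges_between H (L u) (L v)"
    using * unfolding edges_between_def by blast+
  ultimately have "{x, y} = {x, z}"
    by (meson disjointD disjoint_iff insertI1)
  then show "y = z" by (metis doubleton_eq_iff)
qed

lemma cover_coloring_of_list_coloring:
  assumes "cover G L H" "list_coloring (adj H) L (pverts G) \<phi>"
  shows "cover_coloring G L H (\<phi> ` pverts G)"
proof -
  have H: "pair_graph H" and dj: "disjoint_family_on L (pverts G)"
    and un: "(\<Union>u\<in>pverts G. L u) = pverts H"
    using coverD[OF assms(1)] by auto
  have mem: "\<phi> v \<in> L v" if "v \<in> pverts G" for v
    using assms(2) that by (simp add: list_coloring_def)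
  have "\<phi> ` pverts G \<inter> L u = {\<phi> u}" if "u \<in> pverts G" for u
  proof -
    have "v = u" if "v \<in> pverts G" "\<phi> v \<in> L u" for v
      using dj mem[OF that(1)] that \<open>u \<in> pverts G\<close> unfolding disjoint_family_on_def by blast
    then show ?thesis using mem that by auto
  qed
  moreover have "\<not> adj H (\<phi> u) (\<phi> v)" if "u \<in> pverts G" "v \<in> pverts G" for u v
    using assms(2) that pair_graphD(2)[OF H] unfolding list_coloring_def by metis
  moreover have "\<phi> ` pverts G \<subseteq> pverts H" using mem unfolding un[symmetric] by blast
  ultimately show ?thesis
    unfolding cover_coloring_def independent_set_def by auto
qed

text \<open>Greedy colouring from the empty colouring. It shows that the \<open>LEAST\<close> in
  \<open>dp_chromatic_number\<close> is attained.\<close>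

lemma dp_colorable_card:
  assumes "finite (pverts G)"
  shows "dp_colorable G (card (pverts G))"
  unfolding dp_colorable_def
proof (intro allI impI, elim conjE)
  fix L :: "'a \<Rightarrow> nat set" and H
  assume *: "cover G L H" "\<forall>u\<in>pverts G. card (pverts G) \<le> card (L u)"
  have "symp (adj H)" using coverD(1)[OF *(1)] by (rule symp_adj)
  then have "\<exists>\<phi>. list_coloring (adj H) L ({} \<union> pverts G) \<phi>"
    using * cover_matched[OF *(1)] cover_finite[OF *(1)] assms
    by (intro list_coloring_extend_set) (auto simp: list_coloring_def lost_def)
  then show "\<exists>I. cover_coloring G L H I"
    using cover_coloring_of_list_coloring[OF *(1)] by auto
qed

subsection \<open>Covers prescribed by relations between colours\<close>

text \<open>Allows the use of particular covers without building them each time: \<open>R\<close>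
  prescribes which colours in \<open>{..<k}\<close> are joined along an edge. \<open>R_sym\<close>
  makes this independent of the orientation, and together with \<open>R_fun\<close> it makes the
  cross edges a matching.\<close>

lemma dp_colorable_relation:
  assumes J: "pair_graph J" and "dp_colorable J k"
    and R_sym: "\<And>u v i j. (u, v) \<in> parcs J \<Longrightarrow> R u v i j \<Longrightarrow> R v u j i"
    and R_fun: "\<And>u v i j j'. (u, v) \<in> parcs J \<Longrightarrow> i < k \<Longrightarrow> j < k \<Longrightarrow> j' < k \<Longrightarrow>
      R u v i j \<Longrightarrow> R u v i j' \<Longrightarrow> j = j'"
  obtains f where "\<And>v. v \<in> pverts J \<Longrightarrow> f v < k"
    and "\<And>u v. (u, v) \<in> parcs J \<Longrightarrow> \<not> R u v (f u) (f v)"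
proof -
  note JD = pair_graphD[OF J]
  \<comment> \<open>\<open>dp_colorable\<close> speaks of covers whose vertices are natural numbers,
    so pairs of a vertex and a colour are coded as numbers.\<close>
  obtain e :: "'a \<Rightarrow> nat" where e: "inj_on e (pverts J)"
    using finite_imp_inj_to_nat_seg[OF JD(1)] by blast
  define enc where "enc v i = prod_encode (e v, i)" for v i
  have enc_eq: "enc u i = enc v j \<longleftrightarrow> u = v \<and> i = j" if "u \<in> pverts J" "v \<in> pverts J" for u v i j
    using e that by (auto simp: enc_def inj_on_eq_iff)
  define L where "L v = enc v ` {..<k}" for v
  define H where "H = \<lparr> pverts = (\<Union>v\<in>pverts J. L v),
    parcs = {(enc v i, enc v j) | v i j. v \<in> pverts J \<and> i < k \<and> j < k \<and> i \<noteq> j}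
      \<union> {(enc u i, enc v j) | u v i j. (u, v) \<in> parcs J \<and> i < k \<and> j < k \<and> R u v i j} \<rparr>"
  have adj_enc: "adj H (enc u i) (enc v j) \<longleftrightarrow>
      (u = v \<and> i \<noteq> j \<or> (u, v) \<in> parcs J \<and> R u v i j)"
    if uv: "u \<in> pverts J" "v \<in> pverts J" "i < k" "j < k" for u v i j
  proof
    assume "adj H (enc u i) (enc v j)"
    then consider (same) w i' j' where "enc u i = enc w i'" "enc v j = enc w j'" "w \<in> pverts J" "i' \<noteq> j'"
      | (arc) u' v' i' j' where "enc u i = enc u' i'" "enc v j = enc v' j'" "(u', v') \<in> parcs J" "R u' v' i' j'"
      by (auto simp: H_def)
    then show "u = v \<and> i \<noteq> j \<or> (u, v) \<in> parcs J \<and> R u v i j"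
    proof cases
      case same
      then show ?thesis using enc_eq uv by auto
    next
      case arc
      then have "u = u'" "i = i'" "v = v'" "j = j'" using enc_eq uv JD(2)[OF arc(3)] by auto
      then show ?thesis using arc by blast
    qed
  next
    assume "u = v \<and> i \<noteq> j \<or> (u, v) \<in> parcs J \<and> R u v i j"
    then show "adj H (enc u i) (enc v j)" using uv by (auto simp: H_def)
  qed
  have HE: "\<exists>u v i j. x = enc u i \<and> y = enc v j \<and> u \<in> pverts J \<and> v \<in> pverts J \<and> i < k \<and> j < k"
    if "adj H x y" for x y
  proof -
    from that consider (same) v i j where "x = enc v i" "y = enc v j" "v \<in> pverts J" "i < k" "j < k"
      | (arc) u v i j where "x = enc u i" "y = enc v j" "(u, v) \<in> parcs J" "i < k" "j < k"
      by (auto simp: H_def)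
    then show ?thesis using JD(2) by cases blast+
  qed
  have LE: "\<exists>i<k. x = enc u i" if "x \<in> L u" for x u using that by (auto simp: L_def)
  have H: "pair_graph H"
  proof (rule pair_graphI)
    show "finite (pverts H)" using JD(1) by (simp add: H_def L_def)
    fix x y assume xy: "adj H x y"
    then obtain u v i j where *: "x = enc u i" "y = enc v j"
      "u \<in> pverts J" "v \<in> pverts J" "i < k" "j < k"
      using HE by blast
    then have uv: "u = v \<and> i \<noteq> j \<or> (u, v) \<in> parcs J \<and> R u v i j"
      using xy adj_enc by blast
    then have "v = u \<and> j \<noteq> i \<or> (v, u) \<in> parcs J \<and> R v u j i"
      using JD(2)[of u v] R_sym[of u v i j] by blast
    then have "adj H y x" using * adj_enc[of v u j i] by blast
    moreover have "x \<noteq> y" using * uv enc_eq[of u v i j] JD(2)[of u v] by blast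
    moreover have "x \<in> pverts H" "y \<in> pverts H" using * by (auto simp: H_def L_def)
    ultimately show "x \<in> pverts H \<and> y \<in> pverts H \<and> x \<noteq> y \<and> adj H y x" by blast
  qed
  have "cover J L H"
    unfolding cover_def
  proof (intro conjI)
    show "pair_graph H" by (rule H)
    show "disjoint_family_on L (pverts J)"
      by (auto simp: disjoint_family_on_def L_def enc_eq)
    show "(\<Union>u\<in>pverts J. L u) = pverts H" by (simp add: H_def)
    show "\<forall>u\<in>pverts J. \<forall>v\<in>pverts J. (\<exists>x\<in>L u. \<exists>y\<in>L v. adj H x y) \<longrightarrow> v = u \<or> (u, v) \<in> parcs J"
    proof (intro ballI impI, elim bexE)
      fix u v x y
      assume *: "u \<in> pverts J" "v \<in> pverts J" "x \<in> L u" "y \<in> L v" "adj H x y"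
      obtain i j where "i < k" "x = enc u i" "j < k" "y = enc v j"
        using LE[OF *(3)] LE[OF *(4)] by blast
      then show "v = u \<or> (u, v) \<in> parcs J" using * adj_enc[of u v i j] by blast
    qed
    show "\<forall>u\<in>pverts J. \<forall>x\<in>L u. \<forall>y\<in>L u. x \<noteq> y \<longrightarrow> adj H x y"
    proof (intro ballI impI)
      fix u x y
      assume *: "u \<in> pverts J" "x \<in> L u" "y \<in> L u" "x \<noteq> y"
      obtain i j where "i < k" "x = enc u i" "j < k" "y = enc u j"
        using LE[OF *(2)] LE[OF *(3)] by blast
      then show "adj H x y" using * adj_enc[of u u i j] by blast
    qed
    show "\<forall>(u, v)\<in>parcs J. matching (edges_between H (L u) (L v))"
    proof clarify
      fix u v assume uv: "(u, v) \<in> parcs J"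
      note uvD = JD(2)[OF uv]
      have ex: "\<exists>i j. E = {enc u i, enc v j} \<and> i < k \<and> j < k \<and> R u v i j"
        if E: "E \<in> edges_between H (L u) (L v)" for E
      proof -
        obtain x y where xy: "E = {x, y}" "x \<in> L u" "y \<in> L v" "adj H x y"
          using E unfolding edges_between_def by blast
        obtain i j where "i < k" "x = enc u i" "j < k" "y = enc v j"
          using LE[OF xy(2)] LE[OF xy(3)] by blast
        then show ?thesis using xy adj_enc[of u v i j] uvD by blast
      qed
      have "E \<inter> F = {}" if EF: "E \<in> edges_between H (L u) (L v)"
        "F \<in> edges_between H (L u) (L v)" "E \<noteq> F" for E F
      proof -
        obtain i j where E: "E = {enc u i, enc v j}" "i < k" "j < k" "R u v i j"
          using ex[OF EF(1)] by blast
        obtain i' j' where F: "F = {enc u i', enc v j'}" "i' < k" "j' < k" "R u v i' j'"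
          using ex[OF EF(2)] by blast
        \<comment> \<open>Functionality along the arc and along its reverse: cross edges that agree
          at one end agree at the other.\<close>
        have "i = i' \<longleftrightarrow> j = j'"
          using R_fun[OF uv, of i j j'] R_fun[of v u j i i'] R_sym[OF uv, of i j]
            R_sym[OF uv, of i' j'] E F uvD by blast
        then show ?thesis using E F EF(3) uvD by (auto simp: enc_eq)
      qed
      then show "matching (edges_between H (L u) (L v))"
        by (auto simp: matching_def intro!: disjointI)
    qed
  qed
  moreover have "card (L v) = k" if "v \<in> pverts J" for v
    unfolding L_def using enc_eq[OF that that] by (subst card_image) (auto simp: inj_on_def)
  ultimately obtain I where I: "cover_coloring J L H I"
    using \<open>dp_colorable J k\<close> unfolding dp_colorable_def by (metis order_refl)
  have "\<exists>i. i < k \<and> enc v i \<in> I" if "v \<in> pverts J" for v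
  proof -
    have "card (I \<inter> L v) = 1" using I that unfolding cover_coloring_def by blast
    then have "I \<inter> L v \<noteq> {}" by auto
    then show ?thesis by (auto simp: L_def)
  qed
  then obtain f where f: "\<And>v. v \<in> pverts J \<Longrightarrow> f v < k \<and> enc v (f v) \<in> I" by metis
  show ?thesis
  proof (rule that[of f])
    show "f v < k" if "v \<in> pverts J" for v using f that by blast
    show "\<not> R u v (f u) (f v)" if "(u, v) \<in> parcs J" for u v
    proof -
      have "u \<in> pverts J" "v \<in> pverts J" using JD(2)[OF that] by blast+
      then have "\<not> adj H (enc u (f u)) (enc v (f v))"
        using f I unfolding cover_coloring_def independent_set_def by blast
      then show ?thesis
        using adj_enc[of u v "f u" "f v"] f \<open>u \<in> pverts J\<close> \<open>v \<in> pverts J\<close> that by blast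
    qed
  qed
qed

text \<open>With the identity matching on every edge, a colouring of the cover is an ordinary proper
  colouring.\<close>

lemma proper_coloring_if_dp_colorable:
  assumes "pair_graph G" "dp_colorable G k"
  shows "\<exists>f. proper_coloring G k f"
proof -
  obtain f where "\<And>v. v \<in> pverts G \<Longrightarrow> f v < k" "\<And>u v. (u, v) \<in> parcs G \<Longrightarrow> f u \<noteq> f v"
    using dp_colorable_relation[OF assms, of "\<lambda>_ _ i j. i = j"] by metis
  then show ?thesis unfolding proper_coloring_def by auto
qed

subsection \<open>Invariance under isomorphism\<close>

text \<open>A bare \<open>pair_pre_digraph\<close> may have arcs with ends outside its vertex set;
  excluding this lets statements about all arcs be transported along \<open>h\<close>.\<close>

definition iso_map :: "('a \<Rightarrow> 'b) \<Rightarrow> 'a pair_pre_digraph \<Rightarrow> 'b pair_pre_digraph \<Rightarrow> bool" where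
  "iso_map h G G' \<longleftrightarrow>
     parcs G \<subseteq> pverts G \<times> pverts G \<and> parcs G' \<subseteq> pverts G' \<times> pverts G' \<and>
     bij_betw h (pverts G) (pverts G') \<and>
     (\<forall>u\<in>pverts G. \<forall>v\<in>pverts G. (h u, h v) \<in> parcs G' \<longleftrightarrow> (u, v) \<in> parcs G)"

lemma iso_map_arc:
  assumes "iso_map h G G'" "u \<in> pverts G" "v \<in> pverts G"
  shows "(h u, h v) \<in> parcs G' \<longleftrightarrow> (u, v) \<in> parcs G"
  using assms unfolding iso_map_def by simp

lemma iso_map_sym:
  assumes "iso_map h G G'"
  shows "iso_map (the_inv_into (pverts G) h) G' G"
  unfolding iso_map_def
proof (intro conjI ballI)
  have bij: "bij_betw h (pverts G) (pverts G')" using assms by (simp add: iso_map_def)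
  then show "bij_betw (the_inv_into (pverts G) h) (pverts G') (pverts G)"
    by (rule bij_betw_the_inv_into)
  fix u v assume "u \<in> pverts G'" "v \<in> pverts G'"
  then obtain x y where "u = h x" "v = h y" "x \<in> pverts G" "y \<in> pverts G"
    unfolding bij_betw_imp_surj_on[OF bij, symmetric] by blast
  then show "((the_inv_into (pverts G) h u, the_inv_into (pverts G) h v) \<in> parcs G) = ((u, v) \<in> parcs G')"
    using iso_map_arc[OF assms] bij by (simp add: bij_betw_def the_inv_into_f_f)
qed (use assms in \<open>auto simp: iso_map_def\<close>)

lemma iso_map_join:
  assumes "iso_map h G G'"
  shows "iso_map (map_sum h id) (join_complete G s) (join_complete G' s)"
  unfolding iso_map_def
proof (intro conjI ballI)
  have h: "inj_on h (pverts G)" "pverts G' = h ` pverts G"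
    using assms by (auto simp: iso_map_def bij_betw_def)
  show "parcs (join_complete G s) \<subseteq> pverts (join_complete G s) \<times> pverts (join_complete G s)"
    "parcs (join_complete G' s) \<subseteq> pverts (join_complete G' s) \<times> pverts (join_complete G' s)"
    using assms by (auto simp: iso_map_def join_complete_def)
  have "inj_on (map_sum h id) (pverts (join_complete G s))"
  proof (rule inj_onI)
    fix x y
    assume "x \<in> pverts (join_complete G s)" "y \<in> pverts (join_complete G s)"
      "map_sum h id x = map_sum h id y"
    then show "x = y"
      using inj_onD[OF h(1)] by (cases x; cases y) (simp_all add: join_complete_def image_iff)
  qed
  moreover have "pverts (join_complete G' s) = map_sum h id ` pverts (join_complete G s)"
    by (simp add: h(2) join_complete_def image_Un image_image)
  ultimately show "bij_betw (map_sum h id) (pverts (join_complete G s)) (pverts (join_complete G' s))"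
    by (simp add: bij_betw_def)
  fix x y :: "'a + nat" assume "x \<in> pverts (join_complete G s)" "y \<in> pverts (join_complete G s)"
  then show "((map_sum h id x, map_sum h id y) \<in> parcs (join_complete G' s)) =
      ((x, y) \<in> parcs (join_complete G s))"
    using iso_map_arc[OF assms] h(2)
    by (cases x; cases y) (auto simp: join_complete_def)
qed

lemma iso_map_proper:
  assumes "iso_map h G G'" "proper_coloring G' k f"
  shows "proper_coloring G k (f \<circ> h)"
  unfolding proper_coloring_def
proof (intro conjI ballI)
  show "(f \<circ> h) v < k" if "v \<in> pverts G" for v
    using assms that by (auto simp: iso_map_def proper_coloring_def bij_betw_def)
  fix e assume "e \<in> parcs G"
  then obtain u v where "e = (u, v)" "(u, v) \<in> parcs G" "u \<in> pverts G" "v \<in> pverts G"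
    using assms(1) unfolding iso_map_def by blast
  moreover from this have "(h u, h v) \<in> parcs G'" using iso_map_arc[OF assms(1)] by blast
  ultimately show "case e of (u, v) \<Rightarrow> (f \<circ> h) u \<noteq> (f \<circ> h) v"
    using assms(2) unfolding proper_coloring_def by fastforce
qed

text \<open>A cover of \<open>G'\<close> becomes one of \<open>G\<close> by composing the lists with
  \<open>h\<close>; \<open>H\<close> is unchanged, so the same independent set serves both.\<close>

lemma iso_map_dp_colorable:
  assumes h: "iso_map h G G'" and "dp_colorable G k"
  shows "dp_colorable G' k"
  unfolding dp_colorable_def
proof (intro allI impI, elim conjE)
  fix L :: "'b \<Rightarrow> nat set" and H
  assume c: "cover G' L H" and k: "\<forall>u\<in>pverts G'. k \<le> card (L u)"
  have V: "pverts G' = h ` pverts G" and inj: "inj_on h (pverts G)"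
    and arcs: "\<And>u v. (u, v) \<in> parcs G \<Longrightarrow> (h u, h v) \<in> parcs G'"
    using h by (auto simp: iso_map_def bij_betw_def)
  have "cover G (L \<circ> h) H"
    unfolding cover_def matching_def
  proof (intro conjI)
    show "pair_graph H" by (rule coverD(1)[OF c])
    show "disjoint_family_on (L \<circ> h) (pverts G)"
      using coverD(2)[OF c] inj unfolding V disjoint_family_on_def by (simp add: inj_on_eq_iff)
    show "(\<Union>u\<in>pverts G. (L \<circ> h) u) = pverts H"
      using coverD(3)[OF c] unfolding V by (simp add: image_image)
    show "\<forall>u\<in>pverts G. \<forall>v\<in>pverts G.
        (\<exists>x\<in>(L \<circ> h) u. \<exists>y\<in>(L \<circ> h) v. adj H x y) \<longrightarrow> v = u \<or> (u, v) \<in> parcs G"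
    proof (intro ballI impI, elim bexE)
      fix u v x y
      assume uv: "u \<in> pverts G" "v \<in> pverts G"
        and xy: "x \<in> (L \<circ> h) u" "y \<in> (L \<circ> h) v" "adj H x y"
      have "h v = h u \<or> (h u, h v) \<in> parcs G'"
        using xy uv V by (intro coverD(4)[OF c, of _ _ x y]) auto
      then show "v = u \<or> (u, v) \<in> parcs G"
        using iso_map_arc[OF h uv] inj_onD[OF inj _ uv(2,1)] by blast
    qed
    show "\<forall>u\<in>pverts G. \<forall>x\<in>(L \<circ> h) u. \<forall>y\<in>(L \<circ> h) u. x \<noteq> y \<longrightarrow> adj H x y"
      using coverD(5)[OF c] unfolding V by (metis comp_apply imageI)
    show "\<forall>(u, v)\<in>parcs G. disjoint (edges_between H ((L \<circ> h) u) ((L \<circ> h) v))"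
      using coverD(6)[OF c arcs] by auto
  qed
  moreover have "\<forall>u\<in>pverts G. k \<le> card ((L \<circ> h) u)" using k V by auto
  ultimately obtain I where "cover_coloring G (L \<circ> h) H I"
    using \<open>dp_colorable G k\<close> unfolding dp_colorable_def by blast
  then show "\<exists>I. cover_coloring G' L H I"
    unfolding cover_coloring_def V by auto
qed

lemma iso_map_Z_DP:
  assumes "iso_map h G G'"
  shows "Z_DP G = Z_DP G'"
proof -
  have "chromatic_number (join_complete G s) = chromatic_number (join_complete G' s)"
    and "dp_chromatic_number (join_complete G s) = dp_chromatic_number (join_complete G' s)" for s
  proof -
    note h = iso_map_join[OF assms, of s]
    have "(\<exists>f. proper_coloring (join_complete G s) k f) = (\<exists>f. proper_coloring (join_complete G' s) k f)" for k
      using iso_map_proper[OF h] iso_map_proper[OF iso_map_sym[OF h]] by blast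
    then show "chromatic_number (join_complete G s) = chromatic_number (join_complete G' s)"
      by (simp add: chromatic_number_def)
    have "dp_colorable (join_complete G s) k = dp_colorable (join_complete G' s) k" for k
      using iso_map_dp_colorable[OF h] iso_map_dp_colorable[OF iso_map_sym[OF h]] by blast
    then show "dp_chromatic_number (join_complete G s) = dp_chromatic_number (join_complete G' s)"
      by (simp add: dp_chromatic_number_eq)
  qed
  then show ?thesis by (simp add: Z_DP_def)
qed

lemma finite_Z_DP:
  "finite {Z_DP G | G :: nat pair_pre_digraph. pair_graph G \<and> card (pverts G) = n}"
proof (rule finite_subset)
  \<comment> \<open>All digraphs on \<open>{..<n}\<close>, symmetric or not: a finite set that
    contains an isomorphic copy of every graph on \<open>n\<close> vertices.\<close>
  let ?C = "(\<lambda>P. \<lparr>pverts = {..<n}, parcs = P\<rparr>) ` Pow ({..<n} \<times> {..<n})"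
  show "finite (Z_DP ` ?C)" by simp
  show "{Z_DP G | G :: nat pair_pre_digraph. pair_graph G \<and> card (pverts G) = n} \<subseteq> Z_DP ` ?C"
  proof clarify
    fix G :: "nat pair_pre_digraph" assume G: "pair_graph G" "n = card (pverts G)"
    note GD = pair_graphD[OF G(1)]
    obtain h where h: "bij_betw h (pverts G) {..<n}"
      using ex_bij_betw_finite_nat[OF GD(1)] G(2) by (auto simp: atLeast0LessThan)
    then have mem: "h v < n" if "v \<in> pverts G" for v using that by (auto simp: bij_betw_def)
    have inj: "h u = h v \<longleftrightarrow> u = v" if "u \<in> pverts G" "v \<in> pverts G" for u v
      using h that by (auto simp: bij_betw_def inj_on_eq_iff)
    define G' where "G' = \<lparr>pverts = {..<n}, parcs = map_prod h h ` parcs G\<rparr>"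
    have "iso_map h G G'"
      unfolding iso_map_def
    proof (intro conjI ballI)
      show "parcs G \<subseteq> pverts G \<times> pverts G" using GD(2) by auto
      show "parcs G' \<subseteq> pverts G' \<times> pverts G'" using GD(2) mem by (auto simp: G'_def)
      show "bij_betw h (pverts G) (pverts G')" using h by (simp add: G'_def)
      fix u v assume uv: "u \<in> pverts G" "v \<in> pverts G"
      have "(u, v) \<in> parcs G" if huv: "(h u, h v) \<in> map_prod h h ` parcs G"
      proof -
        obtain x y where "(x, y) \<in> parcs G" "h u = h x" "h v = h y" using huv by auto
        then show ?thesis using inj[of u x] inj[of v y] uv GD(2)[of x y] by simp
      qed
      then show "((h u, h v) \<in> parcs G') = ((u, v) \<in> parcs G)"
        by (force simp: G'_def)
    qed
    then have "Z_DP G = Z_DP G'" by (rule iso_map_Z_DP)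
    moreover have "G' \<in> ?C" using GD(2) mem by (auto simp: G'_def)
    ultimately show "Z_DP G \<in> Z_DP ` (\<lambda>P. \<lparr>pverts = {..<card (pverts G)}, parcs = P\<rparr>) `
        Pow ({..<card (pverts G)} \<times> {..<card (pverts G)})"
      using G(2) by blast
  qed
qed

subsection \<open>Complete bipartite graphs\<close>

text \<open>Both sides are numbered consecutively in \<open>nat\<close>, the vertex type over which
  \<open>Z_DP_max\<close> ranges.\<close>

definition complete_bipartite :: "nat \<Rightarrow> nat pair_pre_digraph" where
  "complete_bipartite m = \<lparr>pverts = {..<2 * m},
     parcs = {(u, v). u < 2 * m \<and> v < 2 * m \<and> (u < m \<longleftrightarrow> m \<le> v)}\<rparr>"

lemma pair_graph_complete_bipartite: "pair_graph (complete_bipartite m)"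
  by (rule pair_graphI) (auto simp: complete_bipartite_def)

section \<open>Chromatic and DP-chromatic numbers of the joins\<close>

lemma proper_coloring_lower_bound:
  assumes "0 < m" "proper_coloring (join_complete (complete_bipartite m) s) k f"
  shows "s + 2 \<le> k"
proof -
  let ?J = "join_complete (complete_bipartite m) s"
  \<comment> \<open>One vertex from each side together with the added clique: \<open>s + 2\<close>
    pairwise adjacent vertices.\<close>
  let ?S = "{Inl 0, Inl m} \<union> Inr ` {..<s} :: (nat + nat) set"
  have f: "f x < k" if "x \<in> pverts ?J" for x
    using assms(2) that by (simp add: proper_coloring_def)
  have arc: "f x \<noteq> f y" if "(x, y) \<in> parcs ?J" for x y
    using assms(2) that by (auto simp: proper_coloring_def)
  have "(x, y) \<in> parcs ?J" if "x \<in> ?S" "y \<in> ?S" "x \<noteq> y" for x y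
    using that assms(1) by (auto simp: join_complete_def complete_bipartite_def)
  then have "inj_on f ?S"
    using arc by (meson inj_onI)
  moreover have "?S \<subseteq> pverts ?J"
    using assms(1) by (auto simp: join_complete_def complete_bipartite_def)
  then have "f ` ?S \<subseteq> {..<k}"
    using f by blast
  ultimately have "card ?S \<le> k" by (metis card_inj_on_le card_lessThan finite_lessThan)
  moreover have "card ?S = s + 2"
  proof -
    have "card ?S = card {Inl 0, Inl m :: nat + nat} + card (Inr ` {..<s} :: (nat + nat) set)"
      by (rule card_Un_disjoint) auto
    then show ?thesis using assms(1) by (simp add: card_image)
  qed
  ultimately show ?thesis by simp
qed

lemma chromatic_number_join_complete_bipartite:
  assumes "0 < m"
  shows "chromatic_number (join_complete (complete_bipartite m) s) = s + 2"
  unfolding chromatic_number_def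
proof (rule Least_equality)
  let ?f = "\<lambda>x. case x of Inl u \<Rightarrow> if u < m then s else s + 1 | Inr i \<Rightarrow> i"
  have "proper_coloring (join_complete (complete_bipartite m) s) (s + 2) ?f"
    by (auto simp: proper_coloring_def join_complete_def complete_bipartite_def split: if_splits)
  then show "\<exists>f. proper_coloring (join_complete (complete_bipartite m) s) (s + 2) f" by blast
qed (use proper_coloring_lower_bound[OF assms] in blast)

text \<open>With lists of size at least \<open>s + 2\<close>, each of the \<open>2 * m\<close>
  bipartite vertices contributes at most \<open>m + 1\<close> to the sum in the general induction;
  this gives the explicit threshold.\<close>

lemma dp_colorable_join_complete_bipartite:
  assumes "m * m + 1 + 2 * (2 * m * (m + 1)) \<le> s"
  shows "dp_colorable (join_complete (complete_bipartite m) s) (s + 2)"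
  unfolding dp_colorable_def
proof (intro allI impI, elim conjE)
  let ?J = "join_complete (complete_bipartite m) s"
  fix L :: "nat + nat \<Rightarrow> nat set" and H
  assume c: "cover ?J L H" and k: "\<forall>u\<in>pverts ?J. s + 2 \<le> card (L u)"
  define A :: "(nat + nat) set" where "A = Inr ` {..<s}"
  define X :: "(nat + nat) set" where "X = Inl ` {..<m}"
  define Y :: "(nat + nat) set" where "Y = Inl ` {m..<2 * m}"
  have "{..<2 * m} = {..<m} \<union> {m..<2 * m}" by auto
  then have V: "pverts ?J = A \<union> (X \<union> Y)"
    by (simp add: A_def X_def Y_def join_complete_def complete_bipartite_def image_Un Un_commute)
  have card: "card A = s" "card X = m" "card Y = m"
    by (auto simp: A_def X_def Y_def card_image)
  have "(\<Sum>u\<in>X\<union>Y. Suc (s + m + 1 - card (L u))) \<le> (\<Sum>u\<in>X\<union>Y. m + 1)"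
  proof (rule sum_mono)
    fix u assume "u \<in> X \<union> Y"
    then have "s + 2 \<le> card (L u)" using k V by blast
    then show "Suc (s + m + 1 - card (L u)) \<le> m + 1" by linarith
  qed
  also have "\<dots> = card (X \<union> Y) * (m + 1)" by simp
  also have "\<dots> \<le> 2 * m * (m + 1)"
    using card_Un_le[of X Y] card by (intro mult_le_mono1) linarith
  finally have "m * m + 1 + 2 * (\<Sum>u\<in>X\<union>Y. Suc (card A + m + 1 - card (L u))) \<le> card A"
    unfolding card(1) using assms by linarith
  moreover have "separated (adj H) L X" "separated (adj H) L Y"
    by (rule cover_separated[OF c];
        auto simp: X_def Y_def join_complete_def complete_bipartite_def)+
  ultimately have "\<exists>\<phi>. list_coloring (adj H) L (A \<union> (X \<union> Y)) \<phi>"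
    using symp_adj[OF coverD(1)[OF c]] cover_matched[OF c] cover_finite[OF c] k card V
    by (intro list_colorable_join_bipartite[where m = m])
      (auto simp: A_def X_def Y_def)
  then show "\<exists>I. cover_coloring ?J L H I"
    using cover_coloring_of_list_coloring[OF c] V by metis
qed

text \<open>The matchings between \<open>u < m\<close> and \<open>v \<ge> m\<close> are cyclic shifts of the \<open>s + 2\<close> colours. As the
  clique uses up \<open>s\<close> colours, only two colours remain for the bipartite graph. The zero shifts on
  the spanning tree of the edges incident with \<open>0\<close> or \<open>m\<close> force each of the two sides to be
  monochromatic, and the other \<open>(m - 1)\<^sup>2\<close> edges realise all nonzero shifts.\<close>

lemma not_dp_colorable_join_complete_bipartite:
  assumes "0 < m" "s + 1 \<le> (m - 1) * (m - 1)"
  shows "\<not> dp_colorable (join_complete (complete_bipartite m) s) (s + 2)"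
proof
  let ?J = "join_complete (complete_bipartite m) s"
  define k where "k = s + 2"
  assume "dp_colorable ?J (s + 2)"
  then have dp: "dp_colorable ?J k" by (simp add: k_def)
  \<comment> \<open>The edges avoiding \<open>0\<close> and \<open>m\<close> are numbered row by row
    in rows of length \<open>m - 1\<close>, so their shifts are \<open>1\<close> up to
    \<open>(m - 1) * (m - 1)\<close>. The nonzero shifts modulo \<open>k\<close> are
    \<open>1\<close> up to \<open>s + 1\<close>, whence the hypothesis on \<open>s\<close>.\<close>
  define \<sigma> where "\<sigma> u v = (if u = 0 \<or> v = m then 0 else 1 + (u - 1) * (m - 1) + (v - m - 1))" for u v
  \<comment> \<open>The two branches describe one matching seen from either end; every edge meeting
    the clique carries equality.\<close>
  define R where "R p q i j = (case (p, q) of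
      (Inl u, Inl v) \<Rightarrow> if u < m then j = (i + \<sigma> u v) mod k else i = (j + \<sigma> v u) mod k
    | _ \<Rightarrow> i = j)" for p q :: "nat + nat" and i j
  have cancel: "i = j" if ij: "(i + c) mod k = (j + c) mod k" "i < k" "j < k" for i j c
  proof -
    obtain a b where "i + c + k * a = j + c + k * b"
      using ij(1) unfolding nat_mod_eq_iff by blast
    then have "i + k * a = j + k * b" by simp
    then have "i mod k = j mod k" by (metis mod_mult_self2)
    then show ?thesis using ij by simp
  qed
  obtain f where f: "\<And>v. v \<in> pverts ?J \<Longrightarrow> f v < k"
    and R: "\<And>u v. (u, v) \<in> parcs ?J \<Longrightarrow> \<not> R u v (f u) (f v)"
  proof (rule dp_colorable_relation[OF _ dp, of R])
    show "pair_graph ?J" by (intro pair_graph_join_complete pair_graph_complete_bipartite)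
    show "R v u j i" if "(u, v) \<in> parcs ?J" "R u v i j" for u v i j
      using that by (cases u; cases v)
        (auto simp: R_def join_complete_def complete_bipartite_def split: if_splits)
    show "j = j'" if "(u, v) \<in> parcs ?J" "i < k" "j < k" "j' < k" "R u v i j" "R u v i j'" for u v i j j'
      using that cancel[of j _ j'] by (cases u; cases v) (auto simp: R_def split: if_splits)
  qed blast
  have lt: "f (Inl u) < k" if "u < 2 * m" for u
    using f[of "Inl u"] that by (simp add: join_complete_def complete_bipartite_def)
  have shift: "f (Inl v) \<noteq> (f (Inl u) + \<sigma> u v) mod k" if "u < m" "m \<le> v" "v < 2 * m" for u v
    using R[of "Inl u" "Inl v"] that by (auto simp: R_def join_complete_def complete_bipartite_def)
  define C where "C = f ` Inr ` {..<s}"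
  have "f (Inr i) < k" if "i < s" for i
    using f[of "Inr i"] that by (simp add: join_complete_def)
  then have C_sub: "C \<subseteq> {..<k}" by (auto simp: C_def)
  have "f (Inr i) \<noteq> f (Inr j)" if "i < s" "j < s" "i \<noteq> j" for i j
    using R[of "Inr i" "Inr j"] that by (simp add: R_def join_complete_def)
  then have "inj_on (\<lambda>i. f (Inr i)) {..<s}" by (intro inj_onI) auto
  then have "card C = s" by (simp add: C_def image_image card_image)
  then have two: "card ({..<k} - C) = 2" using C_sub by (simp add: card_Diff_subset finite_subset k_def)
  have rest: "f (Inl u) \<in> {..<k} - C" if "u < 2 * m" for u
  proof -
    have "f (Inl u) \<noteq> f (Inr i)" if "i < s" for i
      using R[of "Inl u" "Inr i"] that \<open>u < 2 * m\<close>
      by (simp add: R_def join_complete_def complete_bipartite_def)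
    then show ?thesis using lt[OF that] by (auto simp: C_def)
  qed
  define p q where "p = f (Inl 0)" and "q = f (Inl m)"
  have pk: "p < k" "q < k" using lt[of 0] lt[of m] assms(1) by (auto simp: p_def q_def)
  have "q \<noteq> p" using shift[of 0 m] assms(1) pk by (simp add: p_def q_def \<sigma>_def)
  have "{p, q} = {..<k} - C"
    using rest[of 0] rest[of m] \<open>q \<noteq> p\<close> two assms(1)
    by (intro card_subset_eq) (auto simp: p_def q_def)
  then have pq: "f (Inl u) = p \<or> f (Inl u) = q" if "u < 2 * m" for u
    using rest[OF that] by blast
  \<comment> \<open>\<open>v\<close> is joined to \<open>0\<close> with shift zero, so it avoids
    \<open>p\<close> and only \<open>q\<close> remains.\<close>
  have fq: "f (Inl v) = q" if "m \<le> v" "v < 2 * m" for v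
    using shift[of 0 v] pq[of v] that assms(1) pk by (simp add: p_def \<sigma>_def)
  have fp: "f (Inl u) = p" if "u < m" for u
    using shift[of u m] pq[of u] lt[of u] that assms(1) by (auto simp: q_def \<sigma>_def)
  \<comment> \<open>The nonzero shift that carries \<open>p\<close> to \<open>q\<close> modulo
    \<open>k\<close>.\<close>
  define \<delta> where "\<delta> = (if p < q then q - p else q + k - p)"
  have \<delta>: "0 < \<delta>" "\<delta> < k" "(p + \<delta>) mod k = q"
    using pk \<open>q \<noteq> p\<close> by (auto simp: \<delta>_def)
  \<comment> \<open>Quotient and remainder invert the numbering in \<open>\<sigma>\<close> and yield
    the edge with shift \<open>\<delta>\<close>, which the colouring violates.\<close>
  define u v where "u = 1 + (\<delta> - 1) div (m - 1)" and "v = m + 1 + (\<delta> - 1) mod (m - 1)"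
  have "\<delta> - 1 < (m - 1) * (m - 1)" using \<delta>(1,2) assms(2) by (simp add: k_def)
  then have "(\<delta> - 1) div (m - 1) < m - 1" by (rule less_mult_imp_div_less)
  moreover from this have "(\<delta> - 1) mod (m - 1) < m - 1" by (intro mod_less_divisor) linarith
  ultimately have uv: "u < m" "m \<le> v" "v < 2 * m" unfolding u_def v_def by linarith+
  have "\<sigma> u v = 1 + ((\<delta> - 1) div (m - 1) * (m - 1) + (\<delta> - 1) mod (m - 1))"
    by (simp add: \<sigma>_def u_def v_def)
  also have "\<dots> = \<delta>" using \<delta>(1) by (simp add: div_mult_mod_eq)
  finally show False using shift[OF uv] fp[OF uv(1)] fq[OF uv(2,3)] \<delta>(3) by simp
qed

text \<open>At \<open>?Z\<close> the two chromatic numbers agree, so lists of size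
  \<open>?Z + 2\<close> always suffice; for a smaller \<open>?Z\<close> the cyclic shifts would
  contradict this.\<close>

lemma Z_DP_complete_bipartite:
  assumes "0 < m"
  shows "(m - 1) * (m - 1) \<le> Z_DP (complete_bipartite m)"
proof -
  let ?J = "join_complete (complete_bipartite m)"
  let ?Z = "Z_DP (complete_bipartite m)"
  have J: "pair_graph (?J s)" for s
    by (intro pair_graph_join_complete pair_graph_complete_bipartite)
  have dp: "dp_colorable (?J s) (dp_chromatic_number (?J s))" for s
    unfolding dp_chromatic_number_eq using dp_colorable_card[OF pair_graphD(1)[OF J]]
    by (rule LeastI)
  \<comment> \<open>A clique size at which the two numbers provably agree; with this witness
    \<open>LeastI\<close> yields agreement at \<open>?Z\<close> itself.\<close>
  define s where "s = m * m + 1 + 2 * (2 * m * (m + 1))"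
  have "dp_chromatic_number (?J s) \<le> s + 2"
    unfolding dp_chromatic_number_eq
    by (intro Least_le dp_colorable_join_complete_bipartite) (simp add: s_def)
  moreover have "s + 2 \<le> dp_chromatic_number (?J s)"
    using proper_coloring_if_dp_colorable[OF J dp] proper_coloring_lower_bound[OF assms] by blast
  ultimately have "dp_chromatic_number (?J s) = chromatic_number (?J s)"
    using chromatic_number_join_complete_bipartite[OF assms] by simp
  then have "dp_chromatic_number (?J ?Z) = chromatic_number (?J ?Z)"
    unfolding Z_DP_def by (rule LeastI)
  then have "dp_colorable (?J ?Z) (?Z + 2)"
    using dp[of ?Z] chromatic_number_join_complete_bipartite[OF assms] by simp
  then show ?thesis
    using not_dp_colorable_join_complete_bipartite[OF assms, of ?Z] by linarith
qed

theorem theorem3p1: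
  fixes n :: nat
  assumes "even n"
  shows "real (Z_DP_max n) \<ge> (real n)\<^sup>2 / 4 - real n"
proof -
  obtain m where n: "n = 2 * m" using assms by (rule evenE)
  show ?thesis
  proof (cases "m = 0")
    case True
    then show ?thesis using n by simp
  next
    case False
    have "pair_graph (complete_bipartite m)" "card (pverts (complete_bipartite m)) = n"
      using pair_graph_complete_bipartite by (auto simp: complete_bipartite_def n)
    then have "Z_DP (complete_bipartite m) \<le> Z_DP_max n"
      unfolding Z_DP_max_def by (intro Max_ge finite_Z_DP) blast
    then have "(m - 1) * (m - 1) \<le> Z_DP_max n"
      using Z_DP_complete_bipartite[of m] False by linarith
    then have "real (m - 1) * real (m - 1) \<le> real (Z_DP_max n)"
      by (metis of_nat_le_iff of_nat_mult)
    moreover have "real (m - 1) = real m - 1" using False by simp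
    \<comment> \<open>For \<open>n = 2 * m\<close> the square of \<open>m - 1\<close> is
      \<open>n^2 / 4 - n + 1\<close>, one above the claimed bound.\<close>
    ultimately show ?thesis by (simp add: n power2_eq_square algebra_simps)
  qed
qed

end
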